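(* Consider the mobility-on-demand fluid model described in the context, with total number of vehicles $V>0$ and total number of drivers $R>0$, and set $D_i:=-\lambda_i+\sum_{j\ne i}\lambda_jp_{ji}$, where $D_i\neq 0$ for all $i\in\mathcal N$. Let $\mathcal A\times\mathcal B$ be the set of assignments $(\alpha,\beta)$ that satisfy $$\sum_{j\ne i}(\alpha_{ij}-\alpha_{ji})=D_i,\qquad \sum_{j\ne i}(\beta_{ij}-\beta_{ji})=-D_i\qquad\text{for each } i\in\mathcal N .$$ Moreover let $$V_\alpha:=\sum_{i,j}T_{ij}(p_{ij}\lambda_i+\alpha_{ij}),\qquad R_{\alpha,\beta}:=\sum_{i,j}T_{ij}(\alpha_{ij}+\beta_{ij}).$$ If $(\alpha,\beta)\notin\mathcal A\times\mathcal B$, then no equilibrium exists. If $(\alpha,\beta)\in\mathcal A\times\mathcal B$, there are two cases: 1. If $V>V_\alpha$ and $R>R_{\alpha,\beta}$, then the set of equilibria is the set of all $(c,v,r)$ with $$c_i=0,\quad v_i>0,\quad r_i>0\quad\forall i\in\mathcal N,\qquad \sum_iv_i=V-V_\alpha,\qquad \sum_ir_i=R-R_{\alpha,\beta}.$$ 2. If $V\le V_\alpha$ or $R\le R_{\alpha,\beta}$, then no equilibrium exists.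
   Context: Parameters: $n$ stations, $\mathcal N=\{1,\dots,n\}$; customer arrival rates $\lambda_i>0$; departure rates $\mu_i>\lambda_i$; destination fractions $p_{ij}\ge 0$ with $p_{ii}=0$ and $\sum_jp_{ij}=1$; travel times $T_{ij}\ge 0$. An assignment $(\alpha,\beta)$ is a pair of $n\times n$ matrices with entries $\alpha_{ij}\ge0$ (vehicle rebalancing rates) and $\beta_{ij}\ge0$ (driver rebalancing rates), $\alpha_{ii}=\beta_{ii}=0$; $\gamma_i=\sum_j\alpha_{ij}$. Model: $c_i(t),v_i(t),r_i(t)\ge 0$ are the (real) numbers of customers, idle vehicles, and idle drivers at station $i$. Let $H(x)=1$ if $x>0$ and $H(x)=0$ otherwise. Unsuperscripted quantities are evaluated at time $t$, and $c_j^i=c_j(t-T_{ji})$, $v_j^i=v_j(t-T_{ji})$, $r_j^i=r_j(t-T_{ji})$. The model is $$\dot c_i=\lambda_i(1-H(v_i))+(\lambda_i-\mu_i)H(c_i)H(v_i),$$ $$\dot v_i=-\lambda_iH(v_i)+(\lambda_i-\mu_i)H(c_i)H(v_i)+\sum_{j\ne i}p_{ji}\bigl(\lambda_jH(v_j^i)-(\lambda_j-\mu_j)H(c_j^i)H(v_j^i)\bigr)-\gamma_iH(v_i)H(r_i)+\sum_{j\ne i}\alpha_{ji}H(v_j^i)H(r_j^i),$$ $$\dot r_i=-\gamma_iH(v_i)H(r_i)+\sum_{j\ne i}\alpha_{ji}H(v_j^i)H(r_j^i)-\sum_{j\ne i}\beta_{ij}H(v_i)H(r_i)+\sum_{j\ne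 i}\beta_{ji}H(v_j^i)H(r_j^i).$$ Equilibrium: a constant vector $(c,v,r)\in\mathbb R_{\ge0}^{3n}$ such that (a) all right-hand sides above vanish when $c_i,v_i,r_i$ and their delayed values are equal to these constants, i.e. $\dot c_i=\dot v_i=\dot r_i=0$ for all $i$; and (b) the total numbers of vehicles and drivers, counting those in transit (for each pair $(i,j)$, departure rate from $i$ to $j$ times $T_{ij}$), equal $V$ and $R$: $$\sum_iv_i+\sum_{i,j}T_{ij}\Bigl[p_{ij}\bigl(\lambda_iH(v_i)-(\lambda_i-\mu_i)H(c_i)H(v_i)\bigr)+\alpha_{ij}H(v_i)H(r_i)\Bigr]=V,$$ $$\sum_ir_i+\sum_{i,j}T_{ij}(\alpha_{ij}+\beta_{ij})H(v_i)H(r_i)=R.$$ *)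

theory Defs
  imports "HOL-Analysis.Analysis"
begin

text \<open>
  Stations are the elements of a finite type \<open>'n\<close>; \<open>lam\<close>, \<open>mu\<close>, \<open>p\<close>, \<open>T\<close> are the arrival
  rates, departure rates, destination fractions and travel times, and a matrix entry
  \<open>M $ i $ j\<close> refers to the trip from \<open>i\<close> to \<open>j\<close>.
\<close>

definition mod_parameters ::
  "real ^ 'n \<Rightarrow> real ^ 'n \<Rightarrow> real ^ 'n ^ 'n \<Rightarrow> real ^ 'n ^ 'n \<Rightarrow> bool" where
  "mod_parameters lam mu p T \<longleftrightarrow>
     (\<forall>i. 0 < lam $ i) \<and> (\<forall>i. lam $ i < mu $ i) \<and>
     (\<forall>i j. 0 \<le> p $ i $ j) \<and> (\<forall>i. p $ i $ i = 0) \<and> (\<forall>i. (\<Sum>j\<in>UNIV. p $ i $ j) = 1) \<and>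
     (\<forall>i j. 0 \<le> T $ i $ j)"

definition rate_matrix :: "real ^ 'n ^ 'n \<Rightarrow> bool" where
  "rate_matrix a \<longleftrightarrow> (\<forall>i j. 0 \<le> a $ i $ j) \<and> (\<forall>i. a $ i $ i = 0)"

definition assignment :: "real ^ 'n ^ 'n \<Rightarrow> real ^ 'n ^ 'n \<Rightarrow> bool" where
  "assignment \<alpha> \<beta> \<longleftrightarrow> rate_matrix \<alpha> \<and> rate_matrix \<beta>"

definition gam :: "real ^ 'n ^ 'n \<Rightarrow> 'n \<Rightarrow> real" where
  "gam \<alpha> i = (\<Sum>j\<in>UNIV. \<alpha> $ i $ j)"

definition H :: "real \<Rightarrow> real" where
  "H x = (if x > 0 then 1 else 0)"

text \<open>
  Right-hand sides of the delay differential equations at time \<open>t\<close>, for trajectories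
  \<open>c\<close>, \<open>v\<close>, \<open>r\<close> of customers, idle vehicles and idle drivers.
\<close>

definition c_rhs ::
  "real ^ 'n \<Rightarrow> real ^ 'n \<Rightarrow> (real \<Rightarrow> real ^ 'n) \<Rightarrow> (real \<Rightarrow> real ^ 'n) \<Rightarrow> real \<Rightarrow> 'n \<Rightarrow> real" where
  "c_rhs lam mu c v t i =
     lam $ i * (1 - H (v t $ i)) + (lam $ i - mu $ i) * H (c t $ i) * H (v t $ i)"

definition v_rhs ::
  "real ^ 'n \<Rightarrow> real ^ 'n \<Rightarrow> real ^ 'n ^ 'n \<Rightarrow> real ^ 'n ^ 'n \<Rightarrow> real ^ 'n ^ 'n \<Rightarrow>
   (real \<Rightarrow> real ^ 'n) \<Rightarrow> (real \<Rightarrow> real ^ 'n) \<Rightarrow> (real \<Rightarrow> real ^ 'n) \<Rightarrow> real \<Rightarrow> 'n \<Rightarrow> real" where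
  "v_rhs lam mu p T \<alpha> c v r t i =
     - lam $ i * H (v t $ i) + (lam $ i - mu $ i) * H (c t $ i) * H (v t $ i)
     + (\<Sum>j\<in>UNIV - {i}. p $ j $ i *
          (lam $ j * H (v (t - T $ j $ i) $ j)
           - (lam $ j - mu $ j) * H (c (t - T $ j $ i) $ j) * H (v (t - T $ j $ i) $ j)))
     - gam \<alpha> i * H (v t $ i) * H (r t $ i)
     + (\<Sum>j\<in>UNIV - {i}. \<alpha> $ j $ i * H (v (t - T $ j $ i) $ j) * H (r (t - T $ j $ i) $ j))"

definition r_rhs ::
  "real ^ 'n ^ 'n \<Rightarrow> real ^ 'n ^ 'n \<Rightarrow> real ^ 'n ^ 'n \<Rightarrow>
   (real \<Rightarrow> real ^ 'n) \<Rightarrow> (real \<Rightarrow> real ^ 'n) \<Rightarrow> real \<Rightarrow> 'n \<Rightarrow> real" where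
  "r_rhs T \<alpha> \<beta> v r t i =
     - gam \<alpha> i * H (v t $ i) * H (r t $ i)
     + (\<Sum>j\<in>UNIV - {i}. \<alpha> $ j $ i * H (v (t - T $ j $ i) $ j) * H (r (t - T $ j $ i) $ j))
     - (\<Sum>j\<in>UNIV - {i}. \<beta> $ i $ j * H (v t $ i) * H (r t $ i))
     + (\<Sum>j\<in>UNIV - {i}. \<beta> $ j $ i * H (v (t - T $ j $ i) $ j) * H (r (t - T $ j $ i) $ j))"

definition total_vehicles ::
  "real ^ 'n \<Rightarrow> real ^ 'n \<Rightarrow> real ^ 'n ^ 'n \<Rightarrow> real ^ 'n ^ 'n \<Rightarrow> real ^ 'n ^ 'n \<Rightarrow>
   real ^ 'n \<Rightarrow> real ^ 'n \<Rightarrow> real ^ 'n \<Rightarrow> real" where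
  "total_vehicles lam mu p T \<alpha> c v r =
     (\<Sum>i\<in>UNIV. v $ i)
     + (\<Sum>i\<in>UNIV. \<Sum>j\<in>UNIV. T $ i $ j *
          (p $ i $ j * (lam $ i * H (v $ i) - (lam $ i - mu $ i) * H (c $ i) * H (v $ i))
           + \<alpha> $ i $ j * H (v $ i) * H (r $ i)))"

definition total_drivers ::
  "real ^ 'n ^ 'n \<Rightarrow> real ^ 'n ^ 'n \<Rightarrow> real ^ 'n ^ 'n \<Rightarrow> real ^ 'n \<Rightarrow> real ^ 'n \<Rightarrow> real" where
  "total_drivers T \<alpha> \<beta> v r =
     (\<Sum>i\<in>UNIV. r $ i)
     + (\<Sum>i\<in>UNIV. \<Sum>j\<in>UNIV. T $ i $ j * (\<alpha> $ i $ j + \<beta> $ i $ j) * H (v $ i) * H (r $ i))"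

definition equilibria ::
  "real ^ 'n \<Rightarrow> real ^ 'n \<Rightarrow> real ^ 'n ^ 'n \<Rightarrow> real ^ 'n ^ 'n \<Rightarrow> real ^ 'n ^ 'n \<Rightarrow> real ^ 'n ^ 'n \<Rightarrow>
   real \<Rightarrow> real \<Rightarrow> ((real ^ 'n) \<times> (real ^ 'n) \<times> (real ^ 'n)) set" where
  "equilibria lam mu p T \<alpha> \<beta> V R = {(c, v, r).
     (\<forall>i. 0 \<le> c $ i \<and> 0 \<le> v $ i \<and> 0 \<le> r $ i) \<and>
     (\<forall>t i. c_rhs lam mu (\<lambda>_. c) (\<lambda>_. v) t i = 0 \<and>
            v_rhs lam mu p T \<alpha> (\<lambda>_. c) (\<lambda>_. v) (\<lambda>_. r) t i = 0 \<and>
            r_rhs T \<alpha> \<beta> (\<lambda>_. v) (\<lambda>_. r) t i = 0) \<and>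
     total_vehicles lam mu p T \<alpha> c v r = V \<and>
     total_drivers T \<alpha> \<beta> v r = R}"

definition D :: "real ^ 'n \<Rightarrow> real ^ 'n ^ 'n \<Rightarrow> 'n \<Rightarrow> real" where
  "D lam p i = - lam $ i + (\<Sum>j\<in>UNIV - {i}. lam $ j * p $ j $ i)"

definition A_set :: "real ^ 'n \<Rightarrow> real ^ 'n ^ 'n \<Rightarrow> (real ^ 'n ^ 'n) set" where
  "A_set lam p = {\<alpha>. rate_matrix \<alpha> \<and>
     (\<forall>i. (\<Sum>j\<in>UNIV - {i}. \<alpha> $ i $ j - \<alpha> $ j $ i) = D lam p i)}"

definition B_set :: "real ^ 'n \<Rightarrow> real ^ 'n ^ 'n \<Rightarrow> (real ^ 'n ^ 'n) set" where
  "B_set lam p = {\<beta>. rate_matrix \<beta> \<and>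
     (\<forall>i. (\<Sum>j\<in>UNIV - {i}. \<beta> $ i $ j - \<beta> $ j $ i) = - D lam p i)}"

definition V_alpha ::
  "real ^ 'n \<Rightarrow> real ^ 'n ^ 'n \<Rightarrow> real ^ 'n ^ 'n \<Rightarrow> real ^ 'n ^ 'n \<Rightarrow> real" where
  "V_alpha lam p T \<alpha> =
     (\<Sum>i\<in>UNIV. \<Sum>j\<in>UNIV. T $ i $ j * (p $ i $ j * lam $ i + \<alpha> $ i $ j))"

definition R_alpha_beta :: "real ^ 'n ^ 'n \<Rightarrow> real ^ 'n ^ 'n \<Rightarrow> real ^ 'n ^ 'n \<Rightarrow> real" where
  "R_alpha_beta T \<alpha> \<beta> = (\<Sum>i\<in>UNIV. \<Sum>j\<in>UNIV. T $ i $ j * (\<alpha> $ i $ j + \<beta> $ i $ j))"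

end

(*
  The customer balance forces v_i > 0 and c_i = 0 at every station. The remaining balances then say
  that D_i is the net rebalancing outflow of vehicles and -D_i that of drivers, each station
  contributing only if it holds idle drivers. A station without idle drivers has no rebalancing
  outflow at all, so D_i <= 0 and -D_i <= 0, contrary to D_i being nonzero. With every indicator
  switched on, the balances become membership in A x B, and the totals fix the sums of v and r.
*)

theory Submission imports Defs
begin

lemma H_pos [simp]: "0 < x \<Longrightarrow> H x = 1"
  by (simp add: H_def)

lemma H_zero [simp]: "H 0 = 0"
  by (simp add: H_def)

lemma H_nonneg: "0 \<le> H x"
  by (simp add: H_def)

text \<open>Without vehicles the queue grows at rate \<open>lam $ i\<close> > 0; with vehicles and
  customers it changes at rate \<open>lam $ i - mu $ i\<close> < 0. Only an empty queue with
  vehicles present is stationary.\<close>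

lemma c_rhs_const_eq_0_iff:
  assumes "0 < lam $ i" "lam $ i < mu $ i" "0 \<le> c $ i" "0 \<le> v $ i"
  shows "c_rhs lam mu (\<lambda>_. c) (\<lambda>_. v) t i = 0 \<longleftrightarrow> 0 < v $ i \<and> c $ i = 0"
  using assms by (auto simp: c_rhs_def H_def)

lemma gam_eq:
  assumes "rate_matrix \<alpha>"
  shows "gam \<alpha> i = (\<Sum>j\<in>UNIV - {i}. \<alpha> $ i $ j)"
  using assms by (simp add: gam_def rate_matrix_def sum.remove[of UNIV i])

text \<open>The factors \<open>H (v $ j)\<close> are left out because it is applied only where every
  station holds vehicles. Delays vanish on constant trajectories, so one expression serves both
  \<alpha> and \<beta>.\<close>

definition net_outflow :: "real ^ 'n ^ 'n \<Rightarrow> real ^ 'n \<Rightarrow> 'n \<Rightarrow> real" where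
  "net_outflow a r i =
     (\<Sum>j\<in>UNIV - {i}. a $ i $ j) * H (r $ i) - (\<Sum>j\<in>UNIV - {i}. a $ j $ i * H (r $ j))"

text \<open>The outgoing term carries the factor \<open>H (r $ i)\<close> = 0, so only the
  subtracted inflow remains.\<close>

lemma net_outflow_nonpos:
  assumes "rate_matrix a" "r $ i = 0"
  shows "net_outflow a r i \<le> 0"
  using assms by (simp add: net_outflow_def rate_matrix_def H_nonneg sum_nonneg)

lemma net_outflow_pos:
  assumes "\<And>j. 0 < r $ j"
  shows "net_outflow a r i = (\<Sum>j\<in>UNIV - {i}. a $ i $ j - a $ j $ i)"
  using assms by (simp add: net_outflow_def sum_subtractf)

lemma v_rhs_const:
  assumes "rate_matrix \<alpha>" "\<And>j. 0 < v $ j" "\<And>j. c $ j = 0"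
  shows "v_rhs lam mu p T \<alpha> (\<lambda>_. c) (\<lambda>_. v) (\<lambda>_. r) t i = D lam p i - net_outflow \<alpha> r i"
  using assms by (simp add: v_rhs_def D_def net_outflow_def gam_eq mult.commute)

lemma r_rhs_const:
  assumes "rate_matrix \<alpha>" "\<And>j. 0 < v $ j"
  shows "r_rhs T \<alpha> \<beta> (\<lambda>_. v) (\<lambda>_. r) t i = - net_outflow \<alpha> r i - net_outflow \<beta> r i"
  using assms by (simp add: r_rhs_def net_outflow_def gam_eq sum_distrib_right)

text \<open>This is where \<open>D lam p i\<close> being nonzero upgrades r \<ge> 0 to r > 0: a
  single station without drivers refutes both sides.\<close>

lemma balances_iff:
  assumes a: "rate_matrix \<alpha>" and b: "rate_matrix \<beta>"
    and D: "\<And>i. D lam p i \<noteq> 0" and r: "\<And>i. 0 \<le> r $ i"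
  shows "(\<forall>i. net_outflow \<alpha> r i = D lam p i \<and> net_outflow \<beta> r i = - D lam p i) \<longleftrightarrow>
    (\<alpha>, \<beta>) \<in> A_set lam p \<times> B_set lam p \<and> (\<forall>i. 0 < r $ i)"
proof (cases "\<forall>i. 0 < r $ i")
  case True
  then show ?thesis
    using a b by (auto simp: net_outflow_pos A_set_def B_set_def)
next
  case False
  then obtain i where "r $ i = 0"
    using r by (meson order.antisym not_le_imp_less)
  then have "net_outflow \<alpha> r i \<le> 0" "net_outflow \<beta> r i \<le> 0"
    using a b by (auto intro: net_outflow_nonpos)
  with D[of i] have "\<not> (net_outflow \<alpha> r i = D lam p i \<and> net_outflow \<beta> r i = - D lam p i)"
    by linarith
  with False show ?thesis by blast
qed

lemma total_vehicles_pos: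
  assumes "\<And>j. 0 < v $ j" "\<And>j. c $ j = 0" "\<And>j. 0 < r $ j"
  shows "total_vehicles lam mu p T \<alpha> c v r = (\<Sum>i\<in>UNIV. v $ i) + V_alpha lam p T \<alpha>"
  using assms by (simp add: total_vehicles_def V_alpha_def)

lemma total_drivers_pos:
  assumes "\<And>j. 0 < v $ j" "\<And>j. 0 < r $ j"
  shows "total_drivers T \<alpha> \<beta> v r = (\<Sum>i\<in>UNIV. r $ i) + R_alpha_beta T \<alpha> \<beta>"
  using assms by (simp add: total_drivers_def R_alpha_beta_def)

text \<open>There is no case distinction on V and R here: the size conditions of the theorem only
  decide whether the two sum equations are compatible with positive entries.\<close>

lemma mem_equilibria_iff:
  assumes par: "mod_parameters lam mu p T" and asg: "assignment \<alpha> \<beta>"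
    and D: "\<And>i. D lam p i \<noteq> 0"
  shows "(c, v, r) \<in> equilibria lam mu p T \<alpha> \<beta> V R \<longleftrightarrow>
    (\<alpha>, \<beta>) \<in> A_set lam p \<times> B_set lam p \<and>
    (\<forall>i. c $ i = 0 \<and> 0 < v $ i \<and> 0 < r $ i) \<and>
    (\<Sum>i\<in>UNIV. v $ i) = V - V_alpha lam p T \<alpha> \<and>
    (\<Sum>i\<in>UNIV. r $ i) = R - R_alpha_beta T \<alpha> \<beta>"
    (is "?L \<longleftrightarrow> ?R")
\<comment> \<open>Here the values of H at c and v are known, while r is only assumed nonnegative,
  since its positivity must come from the balances. Otherwise both sides fail.\<close>
proof (cases "(\<forall>i. c $ i = 0 \<and> 0 < v $ i) \<and> (\<forall>i. 0 \<le> r $ i)")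
  case True
  then have c: "\<And>i. c $ i = 0" and v: "\<And>i. 0 < v $ i" and r: "\<And>i. 0 \<le> r $ i" by auto
  from asg have ab: "rate_matrix \<alpha>" "rate_matrix \<beta>" by (auto simp: assignment_def)
  have "c_rhs lam mu (\<lambda>_. c) (\<lambda>_. v) t i = 0" for t i
    using v c by (simp add: c_rhs_def)
  then have "?L \<longleftrightarrow>
      (\<forall>i. net_outflow \<alpha> r i = D lam p i \<and> net_outflow \<beta> r i = - D lam p i) \<and>
      total_vehicles lam mu p T \<alpha> c v r = V \<and> total_drivers T \<alpha> \<beta> v r = R"
    using c v r ab
    by (auto simp: equilibria_def v_rhs_const r_rhs_const less_imp_le)
  also have "\<dots> \<longleftrightarrow> ?R"
    unfolding balances_iff[OF ab D r] using c v
    by (auto simp: total_vehicles_pos total_drivers_pos)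
  finally show ?thesis .
next
  case False
  have "\<not> ?L"
  proof
    assume L: ?L
    then have "0 \<le> c $ i" "0 \<le> v $ i" "c_rhs lam mu (\<lambda>_. c) (\<lambda>_. v) 0 i = 0" for i
      by (auto simp: equilibria_def)
    moreover have "0 < lam $ i" "lam $ i < mu $ i" for i
      using par by (auto simp: mod_parameters_def)
    ultimately have "0 < v $ i \<and> c $ i = 0" for i
      using c_rhs_const_eq_0_iff by blast
    with False L show False by (auto simp: equilibria_def)
  qed
  with False show ?thesis by (auto simp: less_imp_le)
qed

theorem mainTheorem2:
  fixes lam mu :: "real ^ 'n" and p T \<alpha> \<beta> :: "real ^ 'n ^ 'n" and V R :: real
  assumes "mod_parameters lam mu p T"
    and "assignment \<alpha> \<beta>"
    and "V > 0" and "R > 0"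
    and "\<forall>i. D lam p i \<noteq> 0"
  shows "((\<alpha>, \<beta>) \<notin> A_set lam p \<times> B_set lam p \<longrightarrow> equilibria lam mu p T \<alpha> \<beta> V R = {}) \<and>
    ((\<alpha>, \<beta>) \<in> A_set lam p \<times> B_set lam p \<longrightarrow>
      (V > V_alpha lam p T \<alpha> \<and> R > R_alpha_beta T \<alpha> \<beta> \<longrightarrow>
        equilibria lam mu p T \<alpha> \<beta> V R =
          {(c, v, r). (\<forall>i. c $ i = 0 \<and> v $ i > 0 \<and> r $ i > 0) \<and>
             (\<Sum>i\<in>UNIV. v $ i) = V - V_alpha lam p T \<alpha> \<and>
             (\<Sum>i\<in>UNIV. r $ i) = R - R_alpha_beta T \<alpha> \<beta>}) \<and>
      (V \<le> V_alpha lam p T \<alpha> \<or> R \<le> R_alpha_beta T \<alpha> \<beta> \<longrightarrow>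
        equilibria lam mu p T \<alpha> \<beta> V R = {}))"
proof -
  note mem = mem_equilibria_iff[OF assms(1,2) assms(5)[rule_format], of _ _ _ V R]
  \<comment> \<open>The sums of v and r are strictly positive because there is at least one station,
    every type being nonempty.\<close>
  have "V_alpha lam p T \<alpha> < V \<and> R_alpha_beta T \<alpha> \<beta> < R"
    if "(c, v, r) \<in> equilibria lam mu p T \<alpha> \<beta> V R" for c v r
  proof -
    have "0 < (\<Sum>i\<in>UNIV. v $ i)" "0 < (\<Sum>i\<in>UNIV. r $ i)"
      using that[unfolded mem] by (intro sum_pos; simp)+
    then show ?thesis using that[unfolded mem] by linarith
  qed
  then have "equilibria lam mu p T \<alpha> \<beta> V R = {}"
    if "V \<le> V_alpha lam p T \<alpha> \<or> R \<le> R_alpha_beta T \<alpha> \<beta>"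
    using that by fastforce
  then show ?thesis
    using mem by auto
qed

end
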